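(* For every real $c \ge 1$, the function $h_{\mathbb{H}^2,c} : \mathbb{H}^2 \times \mathbb{H}^2 \to [0,\infty)$ is a metric on the upper half plane $\mathbb{H}^2$.
   Context: For a proper subdomain $D$ of a metric space $(X,d)$ and $c>0$, define $$h_{D,c}(x,y) = \log\left(1+c\,\frac{d(x,y)}{\sqrt{d_D(x)\,d_D(y)}}\right),\qquad x,y\in D,$$ where $d_D(x)=\operatorname{dist}(x,\partial D)$. Here $X=\mathbb{C}=\mathbb{R}^2$ with the Euclidean metric and $D=\mathbb{H}^2=\{z\in\mathbb{C}:\operatorname{Im} z>0\}$ is the upper half plane, so that $d_{\mathbb{H}^2}(x)=\operatorname{Im}(x)$ and $$h_{\mathbb{H}^2,c}(x,y)=\log\left(1+c\,\frac{|x-y|}{\sqrt{\operatorname{Im}(x)\operatorname{Im}(y)}}\right).$$ *)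

theory Defs
  imports "HOL-Analysis.Analysis"
begin

definition boundary_dist :: "'a::metric_space set \<Rightarrow> 'a \<Rightarrow> real" where
  "boundary_dist D x = infdist x (frontier D)"

text \<open>\<open>infdist\<close> is nonnegative and division by zero yields \<open>0\<close>, so for \<open>c \<ge> 0\<close> this is
  nonnegative and symmetric on the whole type, not only on \<open>D\<close>. The locale \<open>Metric_space\<close>
  relies on this: it relativises only the two remaining axioms to the carrier.\<close>

definition h_dist :: "'a::metric_space set \<Rightarrow> real \<Rightarrow> 'a \<Rightarrow> 'a \<Rightarrow> real" where
  "h_dist D c x y =
     ln (1 + c * (dist x y / sqrt (boundary_dist D x * boundary_dist D y)))"

definition upper_half_plane :: "complex set" where
  "upper_half_plane = {z. Im z > 0}"

lemma frontier_upper_half_plane: "frontier upper_half_plane = {z. Im z = 0}"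
proof -
  have "upper_half_plane = {z. \<i> \<bullet> z > 0}"
    by (simp add: upper_half_plane_def inner_complex_def)
  then have "frontier upper_half_plane = {z. \<i> \<bullet> z = 0}"
    using frontier_halfspace_gt[of "\<i>" 0] by simp
  then show ?thesis
    by (simp add: inner_complex_def)
qed

lemma boundary_dist_upper_half_plane:
  assumes "z \<in> upper_half_plane"
  shows "boundary_dist upper_half_plane z = Im z"
proof -
  let ?R = "{w::complex. Im w = 0}"
  have pos: "Im z > 0"
    using assms by (simp add: upper_half_plane_def)
  have le: "Im z \<le> dist z a" if "a \<in> ?R" for a
    using that abs_Im_le_cmod[of "z - a"] by (simp add: dist_norm)
  have ne: "?R \<noteq> {}"
    by (auto intro: exI[of _ 0])
  have "Im z \<le> infdist z ?R"
    unfolding infdist_notempty[OF ne] by (rule cINF_greatest[OF ne le])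
  moreover have "infdist z ?R \<le> dist z (complex_of_real (Re z))"
    by (rule infdist_le) simp
  moreover have "dist z (complex_of_real (Re z)) = Im z"
    using pos by (simp add: dist_norm cmod_def)
  ultimately show ?thesis
    by (simp add: boundary_dist_def frontier_upper_half_plane)
qed

lemma h_dist_upper_half_plane:
  assumes "x \<in> upper_half_plane" "y \<in> upper_half_plane"
  shows "h_dist upper_half_plane c x y = ln (1 + c * (cmod (x - y) / sqrt (Im x * Im y)))"
  using assms by (simp add: h_dist_def boundary_dist_upper_half_plane dist_norm)

end

theory Submission
  imports Defs
begin

text \<open>
  Write \<open>s x y = |x - y| / sqrt (Im x * Im y)\<close>. Exponentiating, the triangle inequality for
  \<open>ln (1 + c * s)\<close> becomes \<open>s x z \<le> s x y + s y z + c * s x y * s y z\<close>, and for \<open>c \<ge> 1\<close> it is enough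
  to have this with \<open>c\<close> replaced by \<open>1\<close>. Geometrically, \<open>s = 2 * sinh (\<rho> / 2)\<close> for the hyperbolic
  distance \<open>\<rho>\<close>, so the claim follows from the triangle inequality for \<open>\<rho>\<close>, the addition formula for
  \<open>sinh\<close>, and \<open>cosh t \<le> 1 + sinh t\<close> for \<open>t \<ge> 0\<close>.

  The proof below expresses these ingredients without hyperbolic functions, by means of the
  reflection of \<open>y\<close> in the real axis: \<open>cosh (\<rho> / 2)\<close> is
  \<open>|x - cnj y| / (2 * sqrt (Im x * Im y))\<close>. The addition formula combined with the triangle
  inequality is then Ptolemy's inequality for the four points \<open>x\<close>, \<open>y\<close>, \<open>z\<close>, \<open>cnj y\<close>, and
  \<open>cosh t \<le> 1 + sinh t\<close> is a bound on the distance to the reflected point.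
\<close>

text \<open>Both products on the right come from an algebraic identity, so that the inequality is just
  the triangle inequality for the modulus.\<close>

lemma Ptolemy_inequality:
  fixes w x y z :: "'a :: real_normed_field"
  shows "norm (x - z) * norm (y - w) \<le> norm (x - y) * norm (z - w) + norm (x - w) * norm (z - y)"
proof -
  have "(x - z) * (y - w) = (x - y) * (z - w) - (x - w) * (z - y)"
    by (simp add: algebra_simps)
  then show ?thesis
    by (metis norm_mult norm_triangle_ineq4)
qed

text \<open>Reflecting one point in the real axis adds \<open>4 * Im y * Im z\<close> to the squared distance, and
  the square root is subadditive.\<close>

lemma cmod_diff_cnj_le:
  assumes "Im y \<ge> 0" "Im z \<ge> 0"
  shows "cmod (z - cnj y) \<le> cmod (z - y) + 2 * (sqrt (Im y) * sqrt (Im z))"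
proof -
  have "(cmod (z - cnj y))\<^sup>2 = (cmod (z - y))\<^sup>2 + 4 * (Im y * Im z)"
    unfolding cmod_power2 by (simp add: power2_eq_square algebra_simps)
  also have "\<dots> = (cmod (z - y))\<^sup>2 + (2 * (sqrt (Im y) * sqrt (Im z)))\<^sup>2"
    using assms by (simp add: power_mult_distrib)
  also have "\<dots> \<le> (cmod (z - y) + 2 * (sqrt (Im y) * sqrt (Im z)))\<^sup>2"
    using assms by (simp add: power2_sum)
  finally show ?thesis
    by (rule power2_le_imp_le) (use assms in simp)
qed

lemma scaled_dist_quasi_triangle:
  assumes "Im x > 0" "Im y > 0" "Im z > 0"
  defines "s \<equiv> \<lambda>u v. cmod (u - v) / sqrt (Im u * Im v)"
  shows "s x z \<le> s x y + s y z + s x y * s y z"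
proof -
  define p q r where "p = sqrt (Im x)" and "q = sqrt (Im y)" and "r = sqrt (Im z)"
  have pos: "p > 0" "q > 0" "r > 0"
    using assms by (simp_all add: p_def q_def r_def)
  define a b where "a = cmod (x - y)" and "b = cmod (y - z)"
  have nonneg: "a \<ge> 0" "b \<ge> 0"
    by (simp_all add: a_def b_def)
  have b': "cmod (z - y) = b"
    by (simp add: b_def norm_minus_commute)
  have "y - cnj y = complex_of_real (2 * Im y) * \<i>"
    by (simp add: complex_eq_iff)
  then have "cmod (y - cnj y) = 2 * q\<^sup>2"
    using assms(2) by (simp add: norm_mult q_def)
  then have "cmod (x - z) * (2 * q\<^sup>2) \<le> a * cmod (z - cnj y) + cmod (x - cnj y) * b"
    using Ptolemy_inequality[of x z y "cnj y"] by (simp add: a_def b')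
  also have "\<dots> \<le> a * (b + 2 * (q * r)) + (a + 2 * (q * p)) * b"
    using cmod_diff_cnj_le[of y z] cmod_diff_cnj_le[of y x] assms nonneg
    by (intro add_mono mult_left_mono mult_right_mono)
       (simp_all add: a_def b' p_def q_def r_def)
  finally have "cmod (x - z) * q\<^sup>2 \<le> a * b + a * (q * r) + b * (p * q)"
    by (simp add: algebra_simps)
  \<comment> \<open>Dividing by \<open>p * q\<^sup>2 * r\<close> normalises all four distances at once.\<close>
  then have "cmod (x - z) * q\<^sup>2 / (p * q\<^sup>2 * r) \<le> (a * b + a * (q * r) + b * (p * q)) / (p * q\<^sup>2 * r)"
    using pos by (intro divide_right_mono) simp_all
  also have "\<dots> = a / (p * q) + b / (q * r) + a / (p * q) * (b / (q * r))"
    using pos by (simp add: field_simps power2_eq_square)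
  finally have "cmod (x - z) / (p * r) \<le> a / (p * q) + b / (q * r) + a / (p * q) * (b / (q * r))"
    using pos by simp
  then show ?thesis
    by (simp add: s_def a_def b_def p_def q_def r_def real_sqrt_mult)
qed

theorem theorem1p3:
  fixes c :: real
  assumes "c \<ge> 1"
  shows "Metric_space upper_half_plane (h_dist upper_half_plane c)"
proof
  fix x y :: complex
  show "0 \<le> h_dist upper_half_plane c x y"
    using assms by (simp add: h_dist_def boundary_dist_def infdist_nonneg)
  show "h_dist upper_half_plane c x y = h_dist upper_half_plane c y x"
    by (simp add: h_dist_def dist_commute mult.commute)
next
  fix x y
  assume xy: "x \<in> upper_half_plane" "y \<in> upper_half_plane"
  then have pos: "Im x > 0" "Im y > 0"
    by (simp_all add: upper_half_plane_def)
  have "0 \<le> c * (cmod (x - y) / sqrt (Im x * Im y))"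
    using pos assms by simp
  then have "h_dist upper_half_plane c x y = 0 \<longleftrightarrow> c * (cmod (x - y) / sqrt (Im x * Im y)) = 0"
    unfolding h_dist_upper_half_plane[OF xy] by (subst ln_eq_zero_iff) linarith+
  also have "\<dots> \<longleftrightarrow> x = y"
    using pos assms by simp
  finally show "h_dist upper_half_plane c x y = 0 \<longleftrightarrow> x = y" .
next
  fix x y z
  assume xyz: "x \<in> upper_half_plane" "y \<in> upper_half_plane" "z \<in> upper_half_plane"
  then have pos: "Im x > 0" "Im y > 0" "Im z > 0"
    by (simp_all add: upper_half_plane_def)
  define s where "s = (\<lambda>u v. cmod (u - v) / sqrt (Im u * Im v))"
  have nonneg: "s x z \<ge> 0" "s x y \<ge> 0" "s y z \<ge> 0"
    using pos by (simp_all add: s_def)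
  have "c * s x z \<le> c * (s x y + s y z + s x y * s y z)"
    using scaled_dist_quasi_triangle[OF pos] assms
    by (intro mult_left_mono) (simp_all add: s_def)
  also have "\<dots> = c * s x y + c * s y z + c * (s x y * s y z)"
    by (simp add: algebra_simps)
  \<comment> \<open>Here \<open>c \<le> c\<^sup>2\<close> enters, that is, \<open>c \<ge> 1\<close>.\<close>
  also have "\<dots> \<le> c * s x y + c * s y z + c * (c * (s x y * s y z))"
    using assms nonneg mult_right_mono[of 1 c "s x y * s y z"]
    by (intro add_left_mono mult_left_mono) simp_all
  finally have *: "1 + c * s x z \<le> (1 + c * s x y) * (1 + c * s y z)"
    by (simp add: algebra_simps)
  have factors_pos: "1 + c * s x z > 0" "1 + c * s x y > 0" "1 + c * s y z > 0"
    using nonneg assms by (simp_all add: add_pos_nonneg)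
  have "ln (1 + c * s x z) \<le> ln ((1 + c * s x y) * (1 + c * s y z))"
    using * factors_pos by (subst ln_le_cancel_iff) simp_all
  also have "\<dots> = ln (1 + c * s x y) + ln (1 + c * s y z)"
    using factors_pos by (simp add: ln_mult)
  finally show "h_dist upper_half_plane c x z \<le>
      h_dist upper_half_plane c x y + h_dist upper_half_plane c y z"
    using xyz by (simp add: h_dist_upper_half_plane s_def)
qed

end
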